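(* Consider the linear program $$p^*=\inf_{(\mu_1,\dots,\mu_m)}\ \sum_{j=1}^m\int_K l_j\,\mathrm{d}\mu_j$$ subject to $\mu_j\in\mathcal{M}^+(K)$, $j=1,\dots,m$, and $$v(T,x_T)-v(0,x_0)=\sum_{j=1}^m\int_K\mathcal{L}'_jv\,\mathrm{d}\mu_j\quad\text{for all } v\in C^1(K).$$ Its conic dual is the problem $$d^*=\sup_{v\in C^1(K)}\ v(T,x_T)-v(0,x_0)\quad\text{subject to}\quad l_j(t,x)-\mathcal{L}'_jv(t,x)\ge 0\ \ \text{for all }(t,x)\in K,\ j=1,\dots,m.$$
   Context: Standing setting: $T>0$, $x_0,x_T\in\mathbb{R}^n$ are given; $X\subset\mathbb{R}^n$ is a given compact set and $K:=[0,T]\times X$; for $j=1,\dots,m$ the functions $f_j:K\to\mathbb{R}^n$ and $l_j:K\to\mathbb{R}$ are continuous in all their variables and Lipschitz continuous with respect to the state variable $x$. $\mathcal{M}(K)$ is the space of finite signed Borel measures on $K$ and $\mathcal{M}^+(K)$ its cone of non-negative measures. $C(K)$ is the space of continuous functions on $K$. $C^1(K)$ denotes the continuously differentiable functions $v(t,x)$, understood as functions in $C^1(\mathbb{R}\times\mathbb{R}^n)$ whose derivatives are evaluated on $K$. The operator $\mathcal{L}'_j:C^1(K)\to C(K)$ is $\mathcal{L}'_jv:=\frac{\partial v}{\partial t}+\frac{\partial v}{\partial x}\cdot f_j$. Conic form: let $E_p:=\mathcal{M}(K)^m$ (weak-$*$ topology), $F_p:=C(K)^m$, with pairing $\langle z,c\rangle_p=\sum_{j=1}^m\int_K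 c_j\,\mathrm{d}z_j$; let $E_p^+:=\mathcal{M}^+(K)^m$; let $F_d:=C^1(K)$ and $E_d:=C^1(K)'$ (topological dual) with pairing $\langle\cdot,\cdot\rangle_d$ between $E_d$ and $F_d$; let $c:=(l_1,\dots,l_m)\in F_p$, $b:=\delta_{(T,x_T)}-\delta_{(0,x_0)}\in E_d$, and let $\mathcal{A}:E_p\to E_d$ be defined by $\langle\mathcal{A}z,v\rangle_d=\sum_{j=1}^m\int_K\mathcal{L}'_jv\,\mathrm{d}z_j$. The linear program over measures is the conic program $\inf\{\langle z,c\rangle_p:\ \mathcal{A}z=b,\ z\in E_p^+\}$. The conic dual of such a program is $\sup\{\langle b,w\rangle_d:\ w\in F_d,\ c-\mathcal{A}'w\in (E_p^+)^*\}$, where $\mathcal{A}':F_d\to F_p$ is the adjoint of $\mathcal{A}$ with respect to the pairings, and $(E_p^+)^*:=\{h\in F_p:\ \langle z,h\rangle_p\ge0\ \text{for all } z\in E_p^+\}$. *)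

theory Defs
  imports "HOL-Analysis.Analysis"
begin

abbreviation borel_sets :: "'a::topological_space set \<Rightarrow> 'a set set" where
  "borel_sets K \<equiv> sets (restrict_space borel K)"

text \<open>A signed measure is a real-valued countably additive set function on the Borel subsets
  of \<open>K\<close>. It is extended by 0 to all other sets, so that equality in \<open>\<M>(K)\<close>
  is equality of functions.\<close>

definition signed_measures :: "'a::topological_space set \<Rightarrow> ('a set \<Rightarrow> real) set" where
  "signed_measures K = {\<mu>. (\<forall>B. B \<notin> borel_sets K \<longrightarrow> \<mu> B = 0) \<and>
     (\<forall>B :: nat \<Rightarrow> 'a set. range B \<subseteq> borel_sets K \<longrightarrow> disjoint_family B \<longrightarrow>
        (\<lambda>i. \<mu> (B i)) sums \<mu> (\<Union>i. B i))}"

definition nonneg_measures :: "'a::topological_space set \<Rightarrow> ('a set \<Rightarrow> real) set" where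
  "nonneg_measures K = {\<mu> \<in> signed_measures K. \<forall>B. 0 \<le> \<mu> B}"

text \<open>The upper variation \<open>\<mu>\<^sup>+(A) = sup {\<mu>(B) | B \<subseteq> A}\<close>. Negative values \<open>\<mu>(B)\<close>, which
  \<open>ennreal\<close> maps to 0, are irrelevant because \<open>B = {}\<close> is admitted.\<close>

definition upper_variation :: "'a::topological_space set \<Rightarrow> ('a set \<Rightarrow> real) \<Rightarrow> 'a measure" where
  "upper_variation K \<mu> = measure_of K (borel_sets K)
     (\<lambda>A. SUP B \<in> {B \<in> borel_sets K. B \<subseteq> A}. ennreal (\<mu> B))"

text \<open>Integration with respect to the Jordan decomposition \<open>\<mu> = \<mu>\<^sup>+ - \<mu>\<^sup>-\<close>,
  \<open>\<mu>\<^sup>- = (-\<mu>)\<^sup>+\<close>.\<close>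

definition signed_integral :: "'a::topological_space set \<Rightarrow> ('a set \<Rightarrow> real) \<Rightarrow> ('a \<Rightarrow> real) \<Rightarrow> real" where
  "signed_integral K \<mu> g =
     integral\<^sup>L (upper_variation K \<mu>) g - integral\<^sup>L (upper_variation K (\<lambda>B. - \<mu> B)) g"

lemma signed_measures_empty:
  assumes "\<mu> \<in> signed_measures K" shows "\<mu> {} = 0"
proof -
  have "(\<lambda>i::nat. \<mu> {}) sums \<mu> (\<Union>i::nat. {})"
    using assms unfolding signed_measures_def
    by (auto dest!: spec[where x = "\<lambda>_. {}"] simp: disjoint_family_on_def)
  then show ?thesis
    by (metis summable_const_iff sums_summable)
qed

lemma nonneg_measures_countably_additive:
  assumes "\<mu> \<in> nonneg_measures K"
  shows "countably_additive (borel_sets K) (\<lambda>B. ennreal (\<mu> B))"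
proof (rule countably_additiveI)
  fix A :: "nat \<Rightarrow> _" assume "range A \<subseteq> borel_sets K" "disjoint_family A"
  then have "(\<lambda>i. \<mu> (A i)) sums \<mu> (\<Union>i. A i)"
    using assms by (simp add: nonneg_measures_def signed_measures_def)
  then show "(\<Sum>i. ennreal (\<mu> (A i))) = ennreal (\<mu> (\<Union>i. A i))"
    using assms by (subst suminf_ennreal2) (auto simp: nonneg_measures_def sums_iff)
qed

lemma nonneg_measures_mono:
  assumes "\<mu> \<in> nonneg_measures K" "A \<in> borel_sets K" "B \<in> borel_sets K" "B \<subseteq> A"
  shows "\<mu> B \<le> \<mu> A"
proof -
  let ?M = "measure_of K (borel_sets K) (\<lambda>B. ennreal (\<mu> B))"
  have sa: "sigma_algebra K (borel_sets K)"
    using sets.sigma_algebra_axioms[of "restrict_space borel K"] by (simp add: space_restrict_space)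
  have pos: "positive (borel_sets K) (\<lambda>B. ennreal (\<mu> B))"
    using assms(1) signed_measures_empty by (auto simp: positive_def nonneg_measures_def)
  note em = emeasure_measure_of_sigma[OF sa pos nonneg_measures_countably_additive[OF assms(1)]]
  have "sets ?M = borel_sets K"
    using sa by (simp add: sigma_algebra.sets_measure_of_eq)
  then have "emeasure ?M B \<le> emeasure ?M A"
    using assms by (intro emeasure_mono) auto
  then have "ennreal (\<mu> B) \<le> ennreal (\<mu> A)"
    using assms by (simp add: em)
  then show ?thesis using assms by (simp add: nonneg_measures_def ennreal_le_iff)
qed

lemma signed_integral_nonneg:
  assumes "\<mu> \<in> nonneg_measures K"
  shows "signed_integral K \<mu> g =
    integral\<^sup>L (measure_of K (borel_sets K) (\<lambda>B. ennreal (\<mu> B))) g"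
proof -
  have sub: "borel_sets K \<subseteq> Pow K"
    using sets.space_closed[of "restrict_space borel K"] by (simp add: space_restrict_space)
  have e0: "\<mu> {} = 0" using assms signed_measures_empty by (auto simp: nonneg_measures_def)
  have sg: "sigma_sets K (borel_sets K) = borel_sets K"
    using sets.sigma_sets_eq[of "restrict_space borel K"] by (simp add: space_restrict_space)
  have 1: "upper_variation K \<mu> = measure_of K (borel_sets K) (\<lambda>B. ennreal (\<mu> B))"
    unfolding upper_variation_def
  proof (rule measure_of_eq[OF sub])
    fix A assume "A \<in> sigma_sets K (borel_sets K)"
    then have A: "A \<in> borel_sets K" by (simp add: sg)
    show "(SUP B \<in> {B \<in> borel_sets K. B \<subseteq> A}. ennreal (\<mu> B)) = ennreal (\<mu> A)"
      using A nonneg_measures_mono[OF assms A]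
      by (intro antisym SUP_least SUP_upper2[of A]) (auto intro: ennreal_leI)
  qed
  have "upper_variation K (\<lambda>B. - \<mu> B) = measure_of K (borel_sets K) (\<lambda>B. 0)"
    unfolding upper_variation_def
  proof (rule measure_of_eq[OF sub])
    fix A assume "A \<in> sigma_sets K (borel_sets K)"
    have "ennreal (- \<mu> B) = 0" for B
      using assms by (auto simp: nonneg_measures_def ennreal_neg)
    then show "(SUP B \<in> {B \<in> borel_sets K. B \<subseteq> A}. ennreal (- \<mu> B)) = 0"
      by (simp add: SUP_constant bot_ennreal)
  qed
  moreover have "integral\<^sup>L (measure_of K (borel_sets K) (\<lambda>B. 0)) g = 0"
  proof (rule integral_eq_zero_AE, rule AE_I')
    show "space (measure_of K (borel_sets K) (\<lambda>B. 0)) \<in> null_sets (measure_of K (borel_sets K) (\<lambda>B. 0))"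
      by (simp add: null_sets_def emeasure_sigma)
  qed auto
  ultimately show ?thesis by (simp add: signed_integral_def 1)
qed

text \<open>Functions on \<open>K\<close> are extended by 0 outside \<open>K\<close>, which makes \<open>C(K)\<close> a space of functions
  with pointwise operations and equality.\<close>

definition C0 :: "'a::topological_space set \<Rightarrow> ('a \<Rightarrow> real) set" where
  "C0 K = {g. continuous_on K g \<and> (\<forall>p. p \<notin> K \<longrightarrow> g p = 0)}"

definition on_set :: "'a set \<Rightarrow> ('a \<Rightarrow> real) \<Rightarrow> 'a \<Rightarrow> real" where
  "on_set K g = (\<lambda>p. if p \<in> K then g p else 0)"

text \<open>An element of \<open>C\<^sup>1(K)\<close> is a \<open>C\<^sup>1\<close> function on the whole of \<open>\<real> \<times> \<real>\<^sup>n\<close>;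
  functions that agree on \<open>K\<close> are not identified. The set \<open>K\<close> enters through \<open>C1_norm\<close> below.\<close>

definition C1 :: "(real \<times> (real ^ 'n) \<Rightarrow> real) set" where
  "C1 = {v. \<exists>v' :: real \<times> (real ^ 'n) \<Rightarrow> (real \<times> (real ^ 'n)) \<Rightarrow>\<^sub>L real.
     (\<forall>p. (v has_derivative blinfun_apply (v' p)) (at p)) \<and> continuous_on UNIV v'}"

definition d_dt :: "(real \<times> (real ^ 'n) \<Rightarrow> real) \<Rightarrow> real \<times> (real ^ 'n) \<Rightarrow> real" where
  "d_dt v = (\<lambda>(t, x). deriv (\<lambda>s. v (s, x)) t)"

definition d_dx :: "(real \<times> (real ^ 'n) \<Rightarrow> real) \<Rightarrow> real \<times> (real ^ 'n) \<Rightarrow> real ^ 'n" where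
  "d_dx v = (\<lambda>(t, x). \<chi> i. deriv (\<lambda>s. v (t, x + s *\<^sub>R axis i 1)) 0)"

text \<open>The \<open>C\<^sup>1\<close> (semi-)norm on \<open>K\<close>; the element 0 only matters when \<open>K\<close> is empty.\<close>

definition C1_norm :: "(real \<times> (real ^ 'n)) set \<Rightarrow> (real \<times> (real ^ 'n) \<Rightarrow> real) \<Rightarrow> real" where
  "C1_norm K v = Sup (insert 0 ((\<lambda>p. \<bar>v p\<bar> + \<bar>d_dt v p\<bar> + norm (d_dx v p)) ` K))"

text \<open>The topological dual \<open>C\<^sup>1(K)'\<close>: bounded linear functionals on \<open>C1\<close>, extended by 0
  to functions outside \<open>C1\<close>.\<close>

definition C1_dual :: "(real \<times> (real ^ 'n)) set \<Rightarrow> ((real \<times> (real ^ 'n) \<Rightarrow> real) \<Rightarrow> real) set" where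
  "C1_dual K = {\<phi>. (\<forall>v. v \<notin> C1 \<longrightarrow> \<phi> v = 0) \<and>
     (\<forall>v \<in> C1. \<forall>w \<in> C1. \<phi> (\<lambda>p. v p + w p) = \<phi> v + \<phi> w) \<and>
     (\<forall>a. \<forall>v \<in> C1. \<phi> (\<lambda>p. a * v p) = a * \<phi> v) \<and>
     (\<exists>M. \<forall>v \<in> C1. \<bar>\<phi> v\<bar> \<le> M * C1_norm K v)}"

definition dirac :: "real \<times> (real ^ 'n) \<Rightarrow> (real \<times> (real ^ 'n) \<Rightarrow> real) \<Rightarrow> real" where
  "dirac p = (\<lambda>v. if v \<in> C1 then v p else 0)"

definition primal_feasible :: "'e set \<Rightarrow> ('e \<Rightarrow> 'g) \<Rightarrow> 'g \<Rightarrow> 'e set" where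
  "primal_feasible P A b = {z \<in> P. A z = b}"

definition primal_value ::
    "('e \<Rightarrow> 'f \<Rightarrow> real) \<Rightarrow> 'e set \<Rightarrow> ('e \<Rightarrow> 'g) \<Rightarrow> 'g \<Rightarrow> 'f \<Rightarrow> ereal" where
  "primal_value pairp P A b c = (INF z \<in> primal_feasible P A b. ereal (pairp z c))"

definition dual_cone :: "'f set \<Rightarrow> ('e \<Rightarrow> 'f \<Rightarrow> real) \<Rightarrow> 'e set \<Rightarrow> 'f set" where
  "dual_cone Fp pairp P = {h \<in> Fp. \<forall>z \<in> P. 0 \<le> pairp z h}"

definition is_adjoint_at ::
    "'e set \<Rightarrow> 'f set \<Rightarrow> ('e \<Rightarrow> 'f \<Rightarrow> real) \<Rightarrow> ('g \<Rightarrow> 'h \<Rightarrow> real) \<Rightarrow> ('e \<Rightarrow> 'g) \<Rightarrow> 'h \<Rightarrow> 'f \<Rightarrow> bool" where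
  "is_adjoint_at Ep Fp pairp paird A w h \<longleftrightarrow> h \<in> Fp \<and> (\<forall>z \<in> Ep. paird (A z) w = pairp z h)"

definition adjoint_op ::
    "'e set \<Rightarrow> 'f set \<Rightarrow> ('e \<Rightarrow> 'f \<Rightarrow> real) \<Rightarrow> ('g \<Rightarrow> 'h \<Rightarrow> real) \<Rightarrow> ('e \<Rightarrow> 'g) \<Rightarrow> 'h \<Rightarrow> 'f" where
  "adjoint_op Ep Fp pairp paird A w = (THE h. is_adjoint_at Ep Fp pairp paird A w h)"

definition dual_feasible ::
    "'e set \<Rightarrow> 'f::minus set \<Rightarrow> 'h set \<Rightarrow> ('e \<Rightarrow> 'f \<Rightarrow> real) \<Rightarrow> ('g \<Rightarrow> 'h \<Rightarrow> real) \<Rightarrow>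
     'e set \<Rightarrow> ('e \<Rightarrow> 'g) \<Rightarrow> 'f \<Rightarrow> 'h set" where
  "dual_feasible Ep Fp Fd pairp paird P A c =
     {w \<in> Fd. c - adjoint_op Ep Fp pairp paird A w \<in> dual_cone Fp pairp P}"

definition dual_value ::
    "'e set \<Rightarrow> 'f::minus set \<Rightarrow> 'h set \<Rightarrow> ('e \<Rightarrow> 'f \<Rightarrow> real) \<Rightarrow> ('g \<Rightarrow> 'h \<Rightarrow> real) \<Rightarrow>
     'e set \<Rightarrow> ('e \<Rightarrow> 'g) \<Rightarrow> 'g \<Rightarrow> 'f \<Rightarrow> ereal" where
  "dual_value Ep Fp Fd pairp paird P A b c =
     (SUP w \<in> dual_feasible Ep Fp Fd pairp paird P A c. ereal (paird b w))"

definition L' :: "(real \<times> (real ^ 'n) \<Rightarrow> real ^ 'n) \<Rightarrow> (real \<times> (real ^ 'n) \<Rightarrow> real) \<Rightarrow>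
    real \<times> (real ^ 'n) \<Rightarrow> real" where
  "L' f v = (\<lambda>p. d_dt v p + d_dx v p \<bullet> f p)"

text \<open>The index set \<open>{1,\<dots>,m}\<close> is the finite type \<open>'m\<close>.\<close>

definition Ep :: "(real \<times> (real ^ 'n)) set \<Rightarrow> ('m::finite \<Rightarrow> (real \<times> (real ^ 'n)) set \<Rightarrow> real) set" where
  "Ep K = {z. \<forall>j. z j \<in> signed_measures K}"

definition Ep_plus :: "(real \<times> (real ^ 'n)) set \<Rightarrow> ('m::finite \<Rightarrow> (real \<times> (real ^ 'n)) set \<Rightarrow> real) set" where
  "Ep_plus K = {z. \<forall>j. z j \<in> nonneg_measures K}"

definition Fp :: "(real \<times> (real ^ 'n)) set \<Rightarrow> ('m::finite \<Rightarrow> real \<times> (real ^ 'n) \<Rightarrow> real) set" where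
  "Fp K = {h. \<forall>j. h j \<in> C0 K}"

definition pair_p :: "(real \<times> (real ^ 'n)) set \<Rightarrow> ('m::finite \<Rightarrow> (real \<times> (real ^ 'n)) set \<Rightarrow> real) \<Rightarrow>
    ('m \<Rightarrow> real \<times> (real ^ 'n) \<Rightarrow> real) \<Rightarrow> real" where
  "pair_p K z h = (\<Sum>j\<in>UNIV. signed_integral K (z j) (h j))"

definition pair_d :: "((real \<times> (real ^ 'n) \<Rightarrow> real) \<Rightarrow> real) \<Rightarrow> (real \<times> (real ^ 'n) \<Rightarrow> real) \<Rightarrow> real" where
  "pair_d \<phi> v = \<phi> v"

definition op_A :: "(real \<times> (real ^ 'n)) set \<Rightarrow> ('m::finite \<Rightarrow> real \<times> (real ^ 'n) \<Rightarrow> real ^ 'n) \<Rightarrow>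
    ('m \<Rightarrow> (real \<times> (real ^ 'n)) set \<Rightarrow> real) \<Rightarrow> (real \<times> (real ^ 'n) \<Rightarrow> real) \<Rightarrow> real" where
  "op_A K f z = (\<lambda>v. if v \<in> C1 then \<Sum>j\<in>UNIV. signed_integral K (z j) (L' (f j) v) else 0)"

definition vec_c :: "(real \<times> (real ^ 'n)) set \<Rightarrow> ('m::finite \<Rightarrow> real \<times> (real ^ 'n) \<Rightarrow> real) \<Rightarrow>
    'm \<Rightarrow> real \<times> (real ^ 'n) \<Rightarrow> real" where
  "vec_c K l = (\<lambda>j. on_set K (l j))"

definition vec_b :: "real \<Rightarrow> real ^ 'n \<Rightarrow> real ^ 'n \<Rightarrow> (real \<times> (real ^ 'n) \<Rightarrow> real) \<Rightarrow> real" where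
  "vec_b T x0 xT = dirac (T, xT) - dirac (0, x0)"

definition lp_feasible :: "real \<Rightarrow> real ^ 'n \<Rightarrow> real ^ 'n \<Rightarrow> (real \<times> (real ^ 'n)) set \<Rightarrow>
    ('m::finite \<Rightarrow> real \<times> (real ^ 'n) \<Rightarrow> real ^ 'n) \<Rightarrow>
    ('m \<Rightarrow> (real \<times> (real ^ 'n)) set \<Rightarrow> real) set" where
  "lp_feasible T x0 xT K f = {\<mu>. (\<forall>j. \<mu> j \<in> nonneg_measures K) \<and>
     (\<forall>v \<in> C1. v (T, xT) - v (0, x0) = (\<Sum>j\<in>UNIV. signed_integral K (\<mu> j) (L' (f j) v)))}"

definition lp_objective :: "(real \<times> (real ^ 'n)) set \<Rightarrow> ('m::finite \<Rightarrow> real \<times> (real ^ 'n) \<Rightarrow> real) \<Rightarrow>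
    ('m \<Rightarrow> (real \<times> (real ^ 'n)) set \<Rightarrow> real) \<Rightarrow> real" where
  "lp_objective K l \<mu> = (\<Sum>j\<in>UNIV. signed_integral K (\<mu> j) (l j))"

definition p_star :: "real \<Rightarrow> real ^ 'n \<Rightarrow> real ^ 'n \<Rightarrow> (real \<times> (real ^ 'n)) set \<Rightarrow>
    ('m::finite \<Rightarrow> real \<times> (real ^ 'n) \<Rightarrow> real ^ 'n) \<Rightarrow> ('m \<Rightarrow> real \<times> (real ^ 'n) \<Rightarrow> real) \<Rightarrow> ereal" where
  "p_star T x0 xT K f l = (INF \<mu> \<in> lp_feasible T x0 xT K f. ereal (lp_objective K l \<mu>))"

definition hjb_feasible :: "(real \<times> (real ^ 'n)) set \<Rightarrow>
    ('m::finite \<Rightarrow> real \<times> (real ^ 'n) \<Rightarrow> real ^ 'n) \<Rightarrow> ('m \<Rightarrow> real \<times> (real ^ 'n) \<Rightarrow> real) \<Rightarrow>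
    (real \<times> (real ^ 'n) \<Rightarrow> real) set" where
  "hjb_feasible K f l = {v \<in> C1. \<forall>j. \<forall>(t, x) \<in> K. l j (t, x) - L' (f j) v (t, x) \<ge> 0}"

definition d_star :: "real \<Rightarrow> real ^ 'n \<Rightarrow> real ^ 'n \<Rightarrow> (real \<times> (real ^ 'n)) set \<Rightarrow>
    ('m::finite \<Rightarrow> real \<times> (real ^ 'n) \<Rightarrow> real ^ 'n) \<Rightarrow> ('m \<Rightarrow> real \<times> (real ^ 'n) \<Rightarrow> real) \<Rightarrow> ereal" where
  "d_star T x0 xT K f l = (SUP v \<in> hjb_feasible K f l. ereal (v (T, xT) - v (0, x0)))"

end

theory Submission
  imports Defs
begin

text \<open>
  Both programs are the abstract conic pair written out, so the content lies in two points.

  The first is that the pairing \<open>\<langle>z, h\<rangle>\<^sub>p\<close> makes sense and is linear and bounded in \<open>h\<close>. A continuous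
  function on the compact set \<open>K\<close> is bounded and measurable, hence integrable with respect to any
  finite measure; what has to be proved is that both variations of a signed measure are finite
  (\<open>bdd_above_signed_measure\<close>). Since \<open>\<L>'\<^sub>j v\<close> is linear in \<open>v\<close> and bounded on \<open>K\<close> by a multiple
  of the \<open>C\<^sup>1\<close> norm, this shows that \<open>\<A> z\<close> belongs to the dual of \<open>C\<^sup>1(K)\<close> (\<open>op_A_in_C1_dual\<close>).

  The second is that point masses are non-negative measures and that integration against the mass
  at \<open>p\<close> evaluates a function at \<open>p\<close>. Testing with a point mass in a single component therefore
  separates the elements of \<open>C(K)\<^sup>m\<close> (\<open>Fp_eqI\<close>), so that the adjoint is unique and has to be
  \<open>v \<mapsto> (\<L>'\<^sub>1 v, \<dots>, \<L>'\<^sub>m v)\<close>; and it identifies the dual of the cone \<open>\<M>\<^sup>+(K)\<^sup>m\<close> with the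
  componentwise non-negative functions (\<open>dual_cone_Ep_plus\<close>). The constraint
  \<open>c - \<A>' v \<in> (E\<^sub>p\<^sup>+)\<^sup>*\<close> then reads \<open>l\<^sub>j - \<L>'\<^sub>j v \<ge> 0\<close> on \<open>K\<close> for all \<open>j\<close>.
\<close>

section \<open>Finiteness of the variations of a signed measure\<close>

lemma sigma_algebra_borel_sets: "sigma_algebra K (borel_sets K)"
  using sets.sigma_algebra_axioms[of "restrict_space borel K"] by (simp add: space_restrict_space)

lemma borel_sets_subset: "borel_sets K \<subseteq> Pow K"
  using sets.space_closed[of "restrict_space borel K"] by (simp add: space_restrict_space)

lemma sigma_sets_borel_sets: "sigma_sets K (borel_sets K) = borel_sets K"
  using sets.sigma_sets_eq[of "restrict_space borel K"] by (simp add: space_restrict_space)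

lemma space_in_borel_sets: "K \<in> borel_sets K"
  using sets.top[of "restrict_space borel K"] by (simp add: space_restrict_space)

lemma signed_measures_uminus:
  assumes "\<mu> \<in> signed_measures K" shows "(\<lambda>B. - \<mu> B) \<in> signed_measures K"
  using assms by (auto simp: signed_measures_def intro: sums_minus)

lemma signed_measures_Un:
  assumes "\<mu> \<in> signed_measures K" "A \<in> borel_sets K" "B \<in> borel_sets K" "A \<inter> B = {}"
  shows "\<mu> (A \<union> B) = \<mu> A + \<mu> B"
proof -
  have "range (binaryset A B) \<subseteq> borel_sets K"
    using assms(2,3) by (auto simp: range_binaryset_eq)
  moreover have "disjoint_family (binaryset A B)"
    using assms(4) by (auto simp: disjoint_family_on_def binaryset_def)
  ultimately have "(\<lambda>i. \<mu> (binaryset A B i)) sums \<mu> (\<Union>i. binaryset A B i)"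
    using assms(1) by (simp add: signed_measures_def)
  moreover have "(\<lambda>i. \<mu> (binaryset A B i)) sums (\<mu> A + \<mu> B)"
    by (rule binaryset_sums[of \<mu>, OF signed_measures_empty[OF assms(1)]])
  ultimately show ?thesis
    by (simp add: UN_binaryset_eq sums_unique2)
qed

lemma signed_measures_Diff:
  assumes "\<mu> \<in> signed_measures K" "A \<in> borel_sets K" "B \<in> borel_sets K" "B \<subseteq> A"
  shows "\<mu> (A - B) = \<mu> A - \<mu> B"
proof -
  have "\<mu> (B \<union> (A - B)) = \<mu> B + \<mu> (A - B)"
    using assms by (intro signed_measures_Un) auto
  moreover have "B \<union> (A - B) = A" using assms(4) by auto
  ultimately show ?thesis by simp
qed

text \<open>The differences of consecutive sets are disjoint, so the series of their values converges by
  countable additivity, and its partial sums telescope.\<close>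

lemma convergent_signed_measure_decseq:
  assumes \<mu>: "\<mu> \<in> signed_measures K" and A: "\<And>n. A n \<in> borel_sets K" "decseq A"
  shows "convergent (\<lambda>n. \<mu> (A n))"
proof -
  have disj: "disjoint_family (\<lambda>n. A n - A (Suc n))"
    unfolding disjoint_family_on_def
  proof (intro ballI impI)
    fix m n :: nat assume "m \<noteq> n"
    then have "A m \<subseteq> A (Suc n) \<or> A n \<subseteq> A (Suc m)"
      using decseqD[OF A(2)] by (metis Suc_leI linorder_neqE_nat)
    then show "(A m - A (Suc m)) \<inter> (A n - A (Suc n)) = {}" by auto
  qed
  have "range (\<lambda>n. A n - A (Suc n)) \<subseteq> borel_sets K" using A(1) by auto
  with disj have "summable (\<lambda>n. \<mu> (A n - A (Suc n)))"
    using \<mu> by (auto simp: signed_measures_def sums_iff)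
  moreover have "\<mu> (A n - A (Suc n)) = \<mu> (A n) - \<mu> (A (Suc n))" for n
    using A by (intro signed_measures_Diff[OF \<mu>]) (auto simp: decseq_Suc_iff)
  ultimately have "convergent (\<lambda>n. \<Sum>i<n. \<mu> (A i) - \<mu> (A (Suc i)))"
    by (simp add: summable_iff_convergent)
  moreover have "(\<Sum>i<n. \<mu> (A i) - \<mu> (A (Suc i))) = \<mu> (A 0) - \<mu> (A n)" for n
    by (induction n) simp_all
  ultimately have "convergent (\<lambda>n. \<mu> (A 0) - \<mu> (A n))" by simp
  from convergent_diff[OF convergent_const[of "\<mu> (A 0)"] this] show ?thesis by simp
qed

text \<open>
  If \<open>\<mu>\<close> is unbounded above on the subsets of \<open>A\<close>, then \<open>A\<close> splits into two parts on both of which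
  \<open>\<bar>\<mu>\<bar>\<close> is large, and \<open>\<mu>\<close> is still unbounded on the subsets of one of them. Iterating gives a
  decreasing sequence of sets along which \<open>\<bar>\<mu>\<bar>\<close> tends to infinity, although \<open>\<mu>\<close> converges along it.
\<close>

lemma bdd_above_signed_measure:
  assumes \<mu>: "\<mu> \<in> signed_measures K"
  shows "bdd_above (\<mu> ` borel_sets K)"
proof (rule ccontr)
  define bdd where "bdd A \<longleftrightarrow> (\<exists>c. \<forall>B \<in> borel_sets K. B \<subseteq> A \<longrightarrow> \<mu> B \<le> c)" for A
  assume unbounded: "\<not> bdd_above (\<mu> ` borel_sets K)"
  have start: "\<not> bdd K"
  proof
    assume "bdd K"
    then obtain c where c: "\<And>B. B \<in> borel_sets K \<Longrightarrow> B \<subseteq> K \<Longrightarrow> \<mu> B \<le> c"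
      unfolding bdd_def by blast
    have "\<mu> B \<le> c" if "B \<in> borel_sets K" for B
      using that borel_sets_subset[of K] by (intro c) auto
    then have "bdd_above (\<mu> ` borel_sets K)" by (rule bdd_aboveI2)
    with unbounded show False by contradiction
  qed
  have step: "\<exists>C \<in> borel_sets K. C \<subseteq> A \<and> \<not> bdd C \<and> r \<le> \<bar>\<mu> C\<bar>"
    if A: "A \<in> borel_sets K" "\<not> bdd A" for A and r :: real
  proof -
    obtain C where C: "C \<in> borel_sets K" "C \<subseteq> A" and big: "\<bar>r\<bar> + \<bar>\<mu> A\<bar> < \<mu> C"
      using A(2) unfolding bdd_def by (metis not_le)
    have AC: "A - C \<in> borel_sets K" using A C by auto
    have "\<mu> (A - C) = \<mu> A - \<mu> C" by (rule signed_measures_Diff[OF \<mu> A(1) C])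
    with big have large: "r \<le> \<bar>\<mu> C\<bar>" "r \<le> \<bar>\<mu> (A - C)\<bar>" by linarith+
    \<comment> \<open>the part to continue with is \<open>C\<close> or \<open>A - C\<close>: were \<open>\<mu>\<close> bounded above on the subsets of
      both, it would be so on the subsets of \<open>A\<close>\<close>
    have "bdd A" if b: "bdd C" "bdd (A - C)"
    proof -
      obtain c1 where c1: "\<And>B. B \<in> borel_sets K \<Longrightarrow> B \<subseteq> C \<Longrightarrow> \<mu> B \<le> c1"
        using b(1) unfolding bdd_def by blast
      obtain c2 where c2: "\<And>B. B \<in> borel_sets K \<Longrightarrow> B \<subseteq> A - C \<Longrightarrow> \<mu> B \<le> c2"
        using b(2) unfolding bdd_def by blast
      have "\<mu> B \<le> c1 + c2" if B: "B \<in> borel_sets K" "B \<subseteq> A" for B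
      proof -
        have "\<mu> ((B \<inter> C) \<union> (B - C)) = \<mu> (B \<inter> C) + \<mu> (B - C)"
          using B C by (intro signed_measures_Un[OF \<mu>]) auto
        moreover have "(B \<inter> C) \<union> (B - C) = B" by auto
        moreover have "\<mu> (B \<inter> C) \<le> c1" using B C by (intro c1) auto
        moreover have "\<mu> (B - C) \<le> c2" using B C by (intro c2) auto
        ultimately show ?thesis by simp
      qed
      then show ?thesis unfolding bdd_def by blast
    qed
    with A(2) C AC large show ?thesis by blast
  qed
  have "\<exists>A. \<forall>n. (A n \<in> borel_sets K \<and> \<not> bdd (A n)) \<and>
      (A (Suc n) \<subseteq> A n \<and> real n \<le> \<bar>\<mu> (A (Suc n))\<bar>)"
  proof (rule dependent_nat_choice)
    show "\<exists>A. A \<in> borel_sets K \<and> \<not> bdd A" using start space_in_borel_sets by blast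
  next
    fix A and n :: nat assume "A \<in> borel_sets K \<and> \<not> bdd A"
    then show "\<exists>C. (C \<in> borel_sets K \<and> \<not> bdd C) \<and> (C \<subseteq> A \<and> real n \<le> \<bar>\<mu> C\<bar>)"
      using step[of A "real n"] by blast
  qed
  then obtain A where A: "\<And>n. A n \<in> borel_sets K \<and> \<not> bdd (A n)"
    and next_A: "\<And>n. A (Suc n) \<subseteq> A n \<and> real n \<le> \<bar>\<mu> (A (Suc n))\<bar>" by blast
  have "convergent (\<lambda>n. \<mu> (A n))"
    using A next_A by (intro convergent_signed_measure_decseq[OF \<mu>]) (auto simp: decseq_Suc_iff)
  then have "Bseq (\<lambda>n. \<mu> (A n))" by (rule convergent_imp_Bseq)
  then obtain M where M: "\<And>n. \<bar>\<mu> (A n)\<bar> \<le> M" by (auto simp: Bseq_def)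
  obtain n where "M < real n" using reals_Archimedean2 by blast
  with M[of "Suc n"] next_A[of n] show False by linarith
qed

section \<open>The signed integral of bounded continuous functions\<close>

lemma sets_upper_variation: "sets (upper_variation K \<mu>) = borel_sets K"
  by (simp add: upper_variation_def sets_measure_of[OF borel_sets_subset] sigma_sets_borel_sets)

lemma space_upper_variation: "space (upper_variation K \<mu>) = K"
  by (simp add: upper_variation_def space_measure_of[OF borel_sets_subset])

text \<open>Whether or not the upper variation is countably additive, it bounds the measure built from it:
  for a set function that is no measure, \<open>measure_of\<close> yields the zero measure.\<close>

lemma finite_measure_upper_variation:
  assumes "\<mu> \<in> signed_measures K"
  shows "finite_measure (upper_variation K \<mu>)"
proof (rule finite_measureI)
  obtain c where c: "\<And>B. B \<in> borel_sets K \<Longrightarrow> \<mu> B \<le> c"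
    using bdd_above_signed_measure[OF assms] by (auto simp: bdd_above_def)
  have "emeasure (upper_variation K \<mu>) K
      \<le> (SUP B \<in> {B \<in> borel_sets K. B \<subseteq> K}. ennreal (\<mu> B))"
    unfolding upper_variation_def by (auto simp: emeasure_measure_of_conv)
  also have "\<dots> \<le> ennreal c"
    using c by (intro SUP_least) (auto intro: ennreal_leI)
  also have "\<dots> < \<infinity>" by simp
  finally show "emeasure (upper_variation K \<mu>) (space (upper_variation K \<mu>)) \<noteq> \<infinity>"
    by (simp add: space_upper_variation)
qed

lemma integrable_upper_variation:
  fixes g :: "'a::topological_space \<Rightarrow> real"
  assumes "\<mu> \<in> signed_measures K" "continuous_on K g" "compact K"
  shows "integrable (upper_variation K \<mu>) g"
proof -
  interpret finite_measure "upper_variation K \<mu>"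
    by (rule finite_measure_upper_variation[OF assms(1)])
  obtain b where "\<And>p. p \<in> K \<Longrightarrow> norm (g p) \<le> b"
    using compact_imp_bounded[OF compact_continuous_image[OF assms(2,3)]]
    by (auto simp: bounded_iff)
  moreover have "g \<in> borel_measurable (upper_variation K \<mu>)"
    using borel_measurable_continuous_on_restrict[OF assms(2)]
    by (simp add: measurable_cong_sets[OF sets_upper_variation refl])
  ultimately show ?thesis
    by (auto simp: space_upper_variation intro!: integrable_const_bound[where B = b] AE_I2)
qed

lemma signed_integral_cong:
  assumes "\<And>p. p \<in> K \<Longrightarrow> g p = h p"
  shows "signed_integral K \<mu> g = signed_integral K \<mu> h"
  unfolding signed_integral_def
  by (intro arg_cong2[of _ _ _ _ "(-)"] Bochner_Integration.integral_cong)
    (auto simp: space_upper_variation assms)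

lemma signed_integral_on_set: "signed_integral K \<mu> (on_set K g) = signed_integral K \<mu> g"
  by (rule signed_integral_cong) (simp add: on_set_def)

lemma signed_integral_add:
  assumes "\<mu> \<in> signed_measures K" "compact K" "continuous_on K g" "continuous_on K h"
  shows "signed_integral K \<mu> (\<lambda>p. g p + h p) = signed_integral K \<mu> g + signed_integral K \<mu> h"
  using assms
  by (simp add: signed_integral_def integrable_upper_variation signed_measures_uminus)

lemma signed_integral_scale: "signed_integral K \<mu> (\<lambda>p. a * g p) = a * signed_integral K \<mu> g"
  by (simp add: signed_integral_def right_diff_distrib)

lemma signed_integral_bound:
  fixes \<mu> :: "'a::topological_space set \<Rightarrow> real"
  assumes \<mu>: "\<mu> \<in> signed_measures K"
  obtains M :: real where "0 \<le> M"
    "\<And>(g :: 'a \<Rightarrow> real) b. 0 \<le> b \<Longrightarrow> (\<And>p. p \<in> K \<Longrightarrow> \<bar>g p\<bar> \<le> b) \<Longrightarrow> \<bar>signed_integral K \<mu> g\<bar> \<le> M * b"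
proof -
  let ?m = "\<lambda>\<nu>. measure (upper_variation K \<nu>) K"
  have one: "\<bar>integral\<^sup>L (upper_variation K \<nu>) g\<bar> \<le> ?m \<nu> * b"
    if \<nu>: "\<nu> \<in> signed_measures K" and b: "0 \<le> b" "\<And>p. p \<in> K \<Longrightarrow> \<bar>g p\<bar> \<le> b" for \<nu> g and b :: real
  proof -
    interpret finite_measure "upper_variation K \<nu>"
      by (rule finite_measure_upper_variation[OF \<nu>])
    show ?thesis
    proof (cases "integrable (upper_variation K \<nu>) g")
      case True
      have "\<bar>integral\<^sup>L (upper_variation K \<nu>) g\<bar> \<le> integral\<^sup>L (upper_variation K \<nu>) (\<lambda>p. \<bar>g p\<bar>)"
        by (rule integral_abs_bound)
      also have "\<dots> \<le> integral\<^sup>L (upper_variation K \<nu>) (\<lambda>_. b)"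
        using True b by (intro integral_mono) (auto simp: space_upper_variation)
      finally show ?thesis by (simp add: space_upper_variation)
    next
      case False
      \<comment> \<open>the integral of a non-integrable function is 0 by convention\<close>
      then show ?thesis using b by (simp add: not_integrable_integral_eq)
    qed
  qed
  show thesis
  proof
    fix g :: "'a \<Rightarrow> real" and b assume b: "0 \<le> b" "\<And>p. p \<in> K \<Longrightarrow> \<bar>g p\<bar> \<le> b"
    show "\<bar>signed_integral K \<mu> g\<bar> \<le> (?m \<mu> + ?m (\<lambda>B. - \<mu> B)) * b"
      using one[of \<mu> b g, OF \<mu> b] one[of "\<lambda>B. - \<mu> B" b g, OF signed_measures_uminus[OF \<mu>] b]
      unfolding signed_integral_def distrib_right by linarith
  qed simp
qed

lemma signed_integral_nonneg_ge_0:
  assumes "\<mu> \<in> nonneg_measures K" "\<And>p. p \<in> K \<Longrightarrow> 0 \<le> g p"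
  shows "0 \<le> signed_integral K \<mu> g"
  unfolding signed_integral_nonneg[OF assms(1)]
  by (intro Bochner_Integration.integral_nonneg)
    (simp add: space_measure_of[OF borel_sets_subset] assms(2))

section \<open>Point masses\<close>

definition point_mass :: "'a::topological_space set \<Rightarrow> 'a \<Rightarrow> 'a set \<Rightarrow> real" where
  "point_mass K p = (\<lambda>B. if B \<in> borel_sets K \<and> p \<in> B then 1 else 0)"

lemma point_mass_nonneg_measure: "point_mass K p \<in> nonneg_measures K"
proof -
  have "(\<lambda>i. point_mass K p (B i)) sums point_mass K p (\<Union>i. B i)"
    if B: "range B \<subseteq> borel_sets K" "disjoint_family B" for B :: "nat \<Rightarrow> 'a set"
  proof (cases "\<exists>i. p \<in> B i")
    case True
    then obtain k where k: "p \<in> B k" by blast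
    have "p \<in> B i \<longleftrightarrow> i = k" for i
      using k B(2) by (auto simp: disjoint_family_on_def)
    then have "(\<lambda>i. point_mass K p (B i)) = (\<lambda>i. if i = k then 1 else 0)"
      using B(1) by (auto simp: point_mass_def)
    moreover have "(\<Union>i. B i) \<in> borel_sets K" using B(1) by blast
    then have "point_mass K p (\<Union>i. B i) = 1" using k by (auto simp: point_mass_def)
    ultimately show ?thesis using sums_single[of k "\<lambda>_. 1::real"] by simp
  qed (auto simp: point_mass_def)
  then show ?thesis
    by (auto simp: nonneg_measures_def signed_measures_def point_mass_def)
qed

lemma zero_nonneg_measure: "(\<lambda>_. 0) \<in> nonneg_measures K"
  by (simp add: nonneg_measures_def signed_measures_def)

lemma signed_integral_zero_measure: "signed_integral K (\<lambda>_. 0) g = 0"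
  by (simp add: signed_integral_def)

text \<open>The point mass at \<open>p\<close> gives measure 0 to \<open>K - {p}\<close>, so every function is almost everywhere
  equal to its value at \<open>p\<close>.\<close>

lemma signed_integral_point_mass:
  fixes K :: "'a::t1_space set"
  assumes p: "p \<in> K" and g: "continuous_on K g"
  shows "signed_integral K (point_mass K p) g = g p"
proof -
  define M where "M = measure_of K (borel_sets K) (\<lambda>B. ennreal (point_mass K p B))"
  have sets_M: "sets M = borel_sets K" and space_M: "space M = K"
    by (simp_all add: M_def sigma_algebra.sets_measure_of_eq[OF sigma_algebra_borel_sets]
        space_measure_of[OF borel_sets_subset])
  have "positive (borel_sets K) (\<lambda>B. ennreal (point_mass K p B))"
    by (simp add: positive_def point_mass_def)
  then have em: "emeasure M B = ennreal (point_mass K p B)" if "B \<in> borel_sets K" for B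
    unfolding M_def using that
    by (intro emeasure_measure_of_sigma sigma_algebra_borel_sets
        nonneg_measures_countably_additive point_mass_nonneg_measure) auto
  have "K - {p} = K \<inter> (- {p})" by auto
  then have Kp: "K - {p} \<in> borel_sets K"
    by (auto simp: sets_restrict_space intro!: image_eqI[of _ _ "- {p}"] borel_open)
  have "g \<in> borel_measurable M"
    using borel_measurable_continuous_on_restrict[OF g]
    by (simp add: measurable_cong_sets[OF sets_M refl])
  moreover have "AE x in M. g x = g p"
    using Kp by (intro AE_I'[of "K - {p}"]) (auto simp: null_sets_def sets_M space_M em point_mass_def)
  ultimately have "integral\<^sup>L M g = integral\<^sup>L M (\<lambda>_. g p)"
    by (intro integral_cong_AE) auto
  also have "\<dots> = g p"
    using p space_in_borel_sets[of K]
    by (simp add: space_M measure_def em point_mass_def)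
  finally show ?thesis
    by (simp add: signed_integral_nonneg[OF point_mass_nonneg_measure] M_def)
qed

lemma pair_p_point_mass:
  fixes h :: "'m::finite \<Rightarrow> real \<times> (real ^ 'n) \<Rightarrow> real"
  assumes "p \<in> K" "continuous_on K (h j)"
  shows "pair_p K ((\<lambda>_ _. 0)(j := point_mass K p)) h = h j p"
proof -
  have "pair_p K ((\<lambda>_ _. 0)(j := point_mass K p)) h = (\<Sum>i\<in>UNIV. if i = j then h j p else 0)"
    unfolding pair_p_def
    by (intro sum.cong)
      (auto simp: signed_integral_zero_measure signed_integral_point_mass[where g = "h j"] assms)
  then show ?thesis by simp
qed

lemma point_mass_in_Ep_plus: "(\<lambda>_ _. 0)(j := point_mass K p) \<in> Ep_plus K"
  by (simp add: Ep_plus_def zero_nonneg_measure point_mass_nonneg_measure)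

lemma Ep_plus_subset_Ep: "Ep_plus K \<subseteq> Ep K"
  by (auto simp: Ep_plus_def Ep_def nonneg_measures_def)

section \<open>The cone dual to the non-negative measures\<close>

lemma Fp_continuous: "h \<in> Fp K \<Longrightarrow> continuous_on K (h j)"
  by (simp add: Fp_def C0_def)

lemma Fp_eqI:
  fixes h k :: "'m::finite \<Rightarrow> real \<times> (real ^ 'n) \<Rightarrow> real"
  assumes h: "h \<in> Fp K" and k: "k \<in> Fp K"
    and eq: "\<And>z. z \<in> Ep_plus K \<Longrightarrow> pair_p K z h = pair_p K z k"
  shows "h = k"
proof (rule ext, rule ext)
  fix j p show "h j p = k j p"
  proof (cases "p \<in> K")
    case True
    with eq[OF point_mass_in_Ep_plus[of j K p]] show ?thesis
      by (simp add: pair_p_point_mass Fp_continuous[OF h] Fp_continuous[OF k])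
  next
    case False
    have "g j p = 0" if "g \<in> Fp K" for g :: "'m \<Rightarrow> real \<times> (real ^ 'n) \<Rightarrow> real"
      using that False unfolding Fp_def C0_def by blast
    with h k show ?thesis by metis
  qed
qed

lemma dual_cone_Ep_plus:
  "dual_cone (Fp K) (pair_p K) (Ep_plus K) = {h \<in> Fp K. \<forall>j. \<forall>p \<in> K. 0 \<le> h j p}"
proof (intro equalityI subsetI)
  fix h assume h: "h \<in> dual_cone (Fp K) (pair_p K) (Ep_plus K)"
  then have Fp: "h \<in> Fp K" by (simp add: dual_cone_def)
  have "0 \<le> h j p" if "p \<in> K" for j p
  proof -
    have "0 \<le> pair_p K ((\<lambda>_ _. 0)(j := point_mass K p)) h"
      using h point_mass_in_Ep_plus[of j K p] by (auto simp: dual_cone_def)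
    then show ?thesis by (simp add: pair_p_point_mass that Fp_continuous[OF Fp])
  qed
  with Fp show "h \<in> {h \<in> Fp K. \<forall>j. \<forall>p \<in> K. 0 \<le> h j p}" by blast
next
  fix h assume "h \<in> {h \<in> Fp K. \<forall>j. \<forall>p \<in> K. 0 \<le> h j p}"
  then show "h \<in> dual_cone (Fp K) (pair_p K) (Ep_plus K)"
    by (auto simp: dual_cone_def pair_p_def Ep_plus_def
        intro!: sum_nonneg signed_integral_nonneg_ge_0)
qed

section \<open>Continuously differentiable functions\<close>

text \<open>\<open>d_dt\<close> and the components of \<open>d_dx\<close> are ordinary derivatives along coordinate lines; the
  chain rule expresses them by the total derivative, which is where linearity in \<open>v\<close> and
  continuity come from.\<close>

lemma has_field_derivative_along_line:
  fixes v :: "'a::real_normed_vector \<Rightarrow> real"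
  assumes "(v has_derivative blinfun_apply D) (at (a + s *\<^sub>R e))"
  shows "((\<lambda>r. v (a + r *\<^sub>R e)) has_field_derivative D e) (at s)"
proof -
  have "((\<lambda>r. a + r *\<^sub>R e) has_derivative (\<lambda>h. h *\<^sub>R e)) (at s)"
    by (auto intro!: derivative_eq_intros)
  from has_derivative_compose[OF this, of v "blinfun_apply D"] assms
  have "((\<lambda>r. v (a + r *\<^sub>R e)) has_derivative (\<lambda>h. D (h *\<^sub>R e))) (at s)" by simp
  moreover have "(\<lambda>h. D (h *\<^sub>R e)) = (*) (D e)"
    by (simp add: fun_eq_iff blinfun.scaleR_right)
  ultimately show ?thesis by (simp add: has_field_derivative_def)
qed

lemma d_dt_eq:
  fixes v :: "real \<times> (real ^ 'n) \<Rightarrow> real"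
  assumes "\<And>p. (v has_derivative blinfun_apply (D p)) (at p)"
  shows "d_dt v = (\<lambda>p. D p (1, 0))"
proof
  fix p :: "real \<times> (real ^ 'n)"
  obtain t x where p: "p = (t, x)" by force
  have "((\<lambda>s. v (s, x)) has_field_derivative D (t, x) (1, 0)) (at t)"
    using has_field_derivative_along_line[of v "D (t, x)" "(0, x)" t "(1, 0)"] assms by simp
  then show "d_dt v p = D p (1, 0)"
    by (simp add: d_dt_def p DERIV_imp_deriv)
qed

lemma d_dx_eq:
  fixes v :: "real \<times> (real ^ 'n) \<Rightarrow> real"
  assumes "\<And>p. (v has_derivative blinfun_apply (D p)) (at p)"
  shows "d_dx v = (\<lambda>p. \<chi> i. D p (0, axis i 1))"
proof
  fix p :: "real \<times> (real ^ 'n)"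
  obtain t x where p: "p = (t, x)" by force
  have "((\<lambda>s. v (t, x + s *\<^sub>R axis i 1)) has_field_derivative D (t, x) (0, axis i 1)) (at 0)" for i
    using has_field_derivative_along_line[of v "D (t, x)" "(t, x)" 0 "(0, axis i 1)"] assms by simp
  then show "d_dx v p = (\<chi> i. D p (0, axis i 1))"
    by (simp add: d_dx_def p vec_eq_iff DERIV_imp_deriv)
qed

lemma C1_cases:
  assumes "v \<in> C1"
  obtains D where "\<And>p. (v has_derivative blinfun_apply (D p)) (at p)" "continuous_on UNIV D"
  using assms by (auto simp: C1_def)

lemma C1_continuous_on:
  assumes "v \<in> C1"
  shows "continuous_on S v" "continuous_on S (d_dt v)" "continuous_on S (d_dx v)"
proof -
  obtain D where D: "\<And>p. (v has_derivative blinfun_apply (D p)) (at p)" "continuous_on UNIV D"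
    using C1_cases[OF assms] by blast
  have "continuous_on S D" using D(2) continuous_on_subset by blast
  then show "continuous_on S (d_dt v)" "continuous_on S (d_dx v)"
    unfolding d_dt_eq[OF D(1)] d_dx_eq[OF D(1)] by (intro continuous_intros; assumption)+
  show "continuous_on S v"
    by (rule has_derivative_continuous_on, rule has_derivative_at_withinI, rule D(1))
qed

lemma C1_add:
  assumes "v \<in> C1" "w \<in> C1"
  shows "(\<lambda>p. v p + w p) \<in> C1"
    and "L' f (\<lambda>p. v p + w p) = (\<lambda>p. L' f v p + L' f w p)"
proof -
  obtain D E where D: "\<And>p. (v has_derivative blinfun_apply (D p)) (at p)" "continuous_on UNIV D"
    and E: "\<And>p. (w has_derivative blinfun_apply (E p)) (at p)" "continuous_on UNIV E"
    using C1_cases[OF assms(1)] C1_cases[OF assms(2)] by metis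
  have S: "((\<lambda>p. v p + w p) has_derivative blinfun_apply (D p + E p)) (at p)" for p
    unfolding plus_blinfun.rep_eq by (rule has_derivative_add[OF D(1) E(1)])
  moreover have "continuous_on UNIV (\<lambda>p. D p + E p)"
    using D(2) E(2) by (rule continuous_on_add)
  ultimately show "(\<lambda>p. v p + w p) \<in> C1"
    unfolding C1_def by (intro CollectI exI[of _ "\<lambda>p. D p + E p"]) blast
  have "d_dx (\<lambda>p. v p + w p) p = d_dx v p + d_dx w p" for p
    by (simp add: d_dx_eq[OF S] d_dx_eq[OF D(1)] d_dx_eq[OF E(1)] blinfun.add_left vec_eq_iff)
  then show "L' f (\<lambda>p. v p + w p) = (\<lambda>p. L' f v p + L' f w p)"
    by (simp add: L'_def fun_eq_iff d_dt_eq[OF S] d_dt_eq[OF D(1)] d_dt_eq[OF E(1)]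
        blinfun.add_left inner_add_left)
qed

lemma C1_scale:
  assumes "v \<in> C1"
  shows "(\<lambda>p. a * v p) \<in> C1"
    and "L' f (\<lambda>p. a * v p) = (\<lambda>p. a * L' f v p)"
proof -
  obtain D where D: "\<And>p. (v has_derivative blinfun_apply (D p)) (at p)" "continuous_on UNIV D"
    using C1_cases[OF assms] by blast
  have S: "((\<lambda>p. a * v p) has_derivative blinfun_apply (a *\<^sub>R D p)) (at p)" for p
    unfolding scaleR_blinfun.rep_eq real_scaleR_def by (rule has_derivative_mult_right[OF D(1)])
  moreover have "continuous_on UNIV (\<lambda>p. a *\<^sub>R D p)"
    using D(2) by (intro continuous_intros)
  ultimately show "(\<lambda>p. a * v p) \<in> C1"
    unfolding C1_def by (intro CollectI exI[of _ "\<lambda>p. a *\<^sub>R D p"]) blast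
  have "d_dx (\<lambda>p. a * v p) p = a *\<^sub>R d_dx v p" for p
    by (simp add: d_dx_eq[OF S] d_dx_eq[OF D(1)] blinfun.scaleR_left vec_eq_iff)
  then show "L' f (\<lambda>p. a * v p) = (\<lambda>p. a * L' f v p)"
    by (simp add: L'_def fun_eq_iff d_dt_eq[OF S] d_dt_eq[OF D(1)] blinfun.scaleR_left distrib_left)
qed

lemma L'_continuous_on:
  assumes "v \<in> C1" "continuous_on K f"
  shows "continuous_on K (L' f v)"
  unfolding L'_def using C1_continuous_on[OF assms(1)] assms(2) by (intro continuous_intros)

lemma C1_norm_upper:
  assumes "compact K" "v \<in> C1"
  shows "p \<in> K \<Longrightarrow> \<bar>v p\<bar> + \<bar>d_dt v p\<bar> + norm (d_dx v p) \<le> C1_norm K v"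
    and "0 \<le> C1_norm K v"
proof -
  have "continuous_on K (\<lambda>p. \<bar>v p\<bar> + \<bar>d_dt v p\<bar> + norm (d_dx v p))"
    using C1_continuous_on[OF assms(2)] by (intro continuous_intros)
  then have bdd: "bdd_above (insert 0 ((\<lambda>p. \<bar>v p\<bar> + \<bar>d_dt v p\<bar> + norm (d_dx v p)) ` K))"
    using assms(1) by (simp add: bounded_imp_bdd_above compact_imp_bounded compact_continuous_image)
  then show "p \<in> K \<Longrightarrow> \<bar>v p\<bar> + \<bar>d_dt v p\<bar> + norm (d_dx v p) \<le> C1_norm K v"
    and "0 \<le> C1_norm K v"
    unfolding C1_norm_def by (auto intro: cSup_upper)
qed

lemma L'_le_C1_norm:
  assumes "compact K" "v \<in> C1" "p \<in> K" "norm (f p) \<le> c"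
  shows "\<bar>L' f v p\<bar> \<le> (1 + c) * C1_norm K v"
proof -
  have le: "\<bar>v p\<bar> + \<bar>d_dt v p\<bar> + norm (d_dx v p) \<le> C1_norm K v"
    by (rule C1_norm_upper(1)[OF assms(1-3)])
  have "\<bar>d_dx v p \<bullet> f p\<bar> \<le> norm (d_dx v p) * norm (f p)" by (rule Cauchy_Schwarz_ineq2)
  also have "\<dots> \<le> C1_norm K v * c"
    using le assms(4) C1_norm_upper(2)[OF assms(1,2)] by (intro mult_mono) auto
  finally have "\<bar>d_dx v p \<bullet> f p\<bar> \<le> C1_norm K v * c" .
  moreover have "\<bar>d_dt v p\<bar> \<le> C1_norm K v" using le norm_ge_zero[of "d_dx v p"] by linarith
  ultimately show ?thesis unfolding L'_def by (simp add: algebra_simps)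
qed

section \<open>The functionals \<open>b\<close> and \<open>\<A> z\<close>, and the adjoint\<close>

lemma vec_b_eq: "v \<in> C1 \<Longrightarrow> vec_b T x0 xT v = v (T, xT) - v (0, x0)"
  by (simp add: vec_b_def dirac_def)

lemma vec_b_in_C1_dual:
  assumes K: "compact K" and "(T, xT) \<in> K" "(0, x0) \<in> K"
  shows "vec_b T x0 xT \<in> C1_dual K"
proof -
  have "\<bar>vec_b T x0 xT v\<bar> \<le> 2 * C1_norm K v" if v: "v \<in> C1" for v
  proof -
    have "\<bar>v p\<bar> \<le> C1_norm K v" if "p \<in> K" for p
      using C1_norm_upper(1)[OF K v that] norm_ge_zero[of "d_dx v p"] by linarith
    from this[OF assms(2)] this[OF assms(3)] show ?thesis
      unfolding vec_b_eq[OF v] by linarith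
  qed
  moreover have "vec_b T x0 xT v = 0" if "v \<notin> C1" for v
    using that by (simp add: vec_b_def dirac_def)
  moreover have "vec_b T x0 xT (\<lambda>p. v p + w p) = vec_b T x0 xT v + vec_b T x0 xT w"
    if "v \<in> C1" "w \<in> C1" for v w
    using that by (simp add: vec_b_eq C1_add)
  moreover have "vec_b T x0 xT (\<lambda>p. a * v p) = a * vec_b T x0 xT v" if "v \<in> C1" for a v
    using that by (simp add: vec_b_eq C1_scale right_diff_distrib)
  ultimately show ?thesis unfolding C1_dual_def by blast
qed

lemma op_A_in_C1_dual:
  fixes f :: "'m::finite \<Rightarrow> real \<times> (real ^ 'n) \<Rightarrow> real ^ 'n"
  assumes K: "compact K" and f: "\<And>j. continuous_on K (f j)" and z: "z \<in> Ep K"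
  shows "op_A K f z \<in> C1_dual K"
proof -
  have zj: "z j \<in> signed_measures K" for j using z by (simp add: Ep_def)
  have "\<exists>M. \<forall>v \<in> C1. \<bar>signed_integral K (z j) (L' (f j) v)\<bar> \<le> M * C1_norm K v" for j
  proof -
    obtain M where M: "0 \<le> M" "\<And>g b. 0 \<le> b \<Longrightarrow> (\<And>p. p \<in> K \<Longrightarrow> \<bar>g p\<bar> \<le> b) \<Longrightarrow>
        \<bar>signed_integral K (z j) g\<bar> \<le> M * b"
      using signed_integral_bound[OF zj] by blast
    obtain c where c: "0 < c" "\<And>p. p \<in> K \<Longrightarrow> norm (f j p) \<le> c"
      using compact_imp_bounded[OF compact_continuous_image[OF f[of j] K]]
      unfolding bounded_pos by blast
    have "\<bar>signed_integral K (z j) (L' (f j) v)\<bar> \<le> M * (1 + c) * C1_norm K v" if v: "v \<in> C1" for v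
      unfolding mult.assoc using c C1_norm_upper(2)[OF K v]
      by (intro M L'_le_C1_norm[OF K v]) auto
    then show ?thesis by blast
  qed
  then obtain M where M: "\<And>j v. v \<in> C1 \<Longrightarrow>
      \<bar>signed_integral K (z j) (L' (f j) v)\<bar> \<le> M j * C1_norm K v" by metis
  have "\<bar>op_A K f z v\<bar> \<le> (\<Sum>j\<in>UNIV. M j) * C1_norm K v" if v: "v \<in> C1" for v
    using v M[OF v] by (auto simp: op_A_def sum_distrib_right intro!: order_trans[OF sum_abs] sum_mono)
  moreover have "op_A K f z (\<lambda>p. v p + w p) = op_A K f z v + op_A K f z w"
    if "v \<in> C1" "w \<in> C1" for v w
    using that by (simp add: op_A_def C1_add signed_integral_add[OF zj K] L'_continuous_on f sum.distrib)
  moreover have "op_A K f z (\<lambda>p. a * v p) = a * op_A K f z v" if "v \<in> C1" for a v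
    using that by (simp add: op_A_def C1_scale signed_integral_scale sum_distrib_left)
  moreover have "op_A K f z v = 0" if "v \<notin> C1" for v
    using that by (simp add: op_A_def)
  ultimately show ?thesis unfolding C1_dual_def by blast
qed

lemma on_set_in_C0:
  assumes "continuous_on K g" shows "on_set K g \<in> C0 K"
proof -
  have "continuous_on K (on_set K g)"
    using assms by (subst continuous_on_cong[OF refl, of K _ g]) (auto simp: on_set_def)
  then show ?thesis by (simp add: C0_def on_set_def)
qed

lemma pair_p_on_set:
  "pair_p K z (\<lambda>j. on_set K (h j)) = (\<Sum>j\<in>UNIV. signed_integral K (z j) (h j))"
  by (simp add: pair_p_def signed_integral_on_set)

text \<open>The formula for the adjoint is the definition of \<open>\<A>\<close> read from right to left; uniqueness is the
  separation of functions by point masses.\<close>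

lemma is_adjoint_at_iff:
  fixes f :: "'m::finite \<Rightarrow> real \<times> (real ^ 'n) \<Rightarrow> real ^ 'n"
  assumes f: "\<And>j. continuous_on K (f j)" and v: "v \<in> C1"
  shows "is_adjoint_at (Ep K) (Fp K) (pair_p K) pair_d (op_A K f) v h \<longleftrightarrow>
    h = (\<lambda>j. on_set K (L' (f j) v))" (is "_ \<longleftrightarrow> h = ?h")
proof -
  have mem: "?h \<in> Fp K" using f v by (simp add: Fp_def on_set_in_C0 L'_continuous_on)
  have eq: "pair_d (op_A K f z) v = pair_p K z ?h" for z
    using v by (simp add: pair_d_def op_A_def pair_p_on_set)
  show ?thesis
  proof
    assume "is_adjoint_at (Ep K) (Fp K) (pair_p K) pair_d (op_A K f) v h"
    then have "h \<in> Fp K" "\<And>z. z \<in> Ep K \<Longrightarrow> pair_p K z h = pair_p K z ?h"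
      by (auto simp: is_adjoint_at_def eq)
    then have "h \<in> Fp K" "\<And>z. z \<in> Ep_plus K \<Longrightarrow> pair_p K z h = pair_p K z ?h"
      using Ep_plus_subset_Ep[of K] by blast+
    then show "h = ?h" using mem by (intro Fp_eqI)
  qed (simp add: is_adjoint_at_def mem eq)
qed

theorem lemma3:
  fixes T :: real and x0 xT :: "real ^ 'n" and X :: "(real ^ 'n) set"
    and K :: "(real \<times> (real ^ 'n)) set"
    and f :: "'m::finite \<Rightarrow> real \<times> (real ^ 'n) \<Rightarrow> real ^ 'n"
    and l :: "'m \<Rightarrow> real \<times> (real ^ 'n) \<Rightarrow> real"
  assumes "T > 0" and "compact X" and "K = {0..T} \<times> X"
    and "\<And>j. continuous_on K (f j)" and "\<And>j. continuous_on K (l j)"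
    and "\<And>j. \<exists>C. \<forall>t \<in> {0..T}. C-lipschitz_on X (\<lambda>x. f j (t, x))"
    and "\<And>j. \<exists>C. \<forall>t \<in> {0..T}. C-lipschitz_on X (\<lambda>x. l j (t, x))"
  shows
    \<comment> \<open>the data of the conic program lie in the stated spaces\<close>
    "vec_c K l \<in> Fp K \<and>
     (x0 \<in> X \<and> xT \<in> X \<longrightarrow> vec_b T x0 xT \<in> C1_dual K) \<and>
     (\<forall>z \<in> Ep K. op_A K f z \<in> C1_dual K) \<and>
     \<comment> \<open>the linear program over measures is the conic program\<close>
     primal_feasible (Ep_plus K) (op_A K f) (vec_b T x0 xT) = lp_feasible T x0 xT K f \<and>
     (\<forall>\<mu> \<in> lp_feasible T x0 xT K f. pair_p K \<mu> (vec_c K l) = lp_objective K l \<mu>) \<and>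
     primal_value (pair_p K) (Ep_plus K) (op_A K f) (vec_b T x0 xT) (vec_c K l)
       = p_star T x0 xT K f l \<and>
     \<comment> \<open>the adjoint is well defined and is given by the operators \<open>\<L>'\<^sub>j\<close>\<close>
     (\<forall>v \<in> C1. \<exists>!h. is_adjoint_at (Ep K) (Fp K) (pair_p K) pair_d (op_A K f) v h) \<and>
     (\<forall>v \<in> C1. adjoint_op (Ep K) (Fp K) (pair_p K) pair_d (op_A K f) v
       = (\<lambda>j. on_set K (L' (f j) v))) \<and>
     \<comment> \<open>the conic dual is the stated problem: same feasible set, objective and value\<close>
     dual_feasible (Ep K) (Fp K) C1 (pair_p K) pair_d (Ep_plus K) (op_A K f) (vec_c K l)
       = hjb_feasible K f l \<and>
     (\<forall>v \<in> hjb_feasible K f l. pair_d (vec_b T x0 xT) v = v (T, xT) - v (0, x0)) \<and>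
     dual_value (Ep K) (Fp K) C1 (pair_p K) pair_d (Ep_plus K) (op_A K f)
         (vec_b T x0 xT) (vec_c K l)
       = d_star T x0 xT K f l"
proof -
  let ?primal = "primal_feasible (Ep_plus K) (op_A K f) (vec_b T x0 xT)"
  let ?dual = "dual_feasible (Ep K) (Fp K) C1 (pair_p K) pair_d (Ep_plus K) (op_A K f) (vec_c K l)"
  have K: "compact K" using assms(2,3) by (simp add: compact_Times)
  note f = assms(4) and l = assms(5)
  have c: "vec_c K l \<in> Fp K" using l by (simp add: vec_c_def Fp_def on_set_in_C0)
  have b: "vec_b T x0 xT \<in> C1_dual K" if "x0 \<in> X" "xT \<in> X"
    using assms(1,3) that by (intro vec_b_in_C1_dual[OF K]) auto
  have A: "op_A K f z \<in> C1_dual K" if "z \<in> Ep K" for z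
    by (rule op_A_in_C1_dual[OF K f that])
  have primal: "?primal = lp_feasible T x0 xT K f"
  proof -
    \<comment> \<open>off \<open>C1\<close> both functionals vanish, so equality of functions adds no constraint there\<close>
    have "op_A K f z = vec_b T x0 xT \<longleftrightarrow>
        (\<forall>v \<in> C1. v (T, xT) - v (0, x0) = (\<Sum>j\<in>UNIV. signed_integral K (z j) (L' (f j) v)))" for z
      by (auto simp: fun_eq_iff op_A_def vec_b_def dirac_def)
    then show ?thesis by (simp add: primal_feasible_def lp_feasible_def Ep_plus_def)
  qed
  have objective: "pair_p K \<mu> (vec_c K l) = lp_objective K l \<mu>" for \<mu>
    by (simp add: vec_c_def lp_objective_def pair_p_on_set)
  note adjoint = is_adjoint_at_iff[OF f]
  have adjoint_eq: "adjoint_op (Ep K) (Fp K) (pair_p K) pair_d (op_A K f) v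
      = (\<lambda>j. on_set K (L' (f j) v))" if "v \<in> C1" for v
    by (simp add: adjoint_op_def adjoint[OF that])
  have dual: "?dual = hjb_feasible K f l"
  proof -
    have "vec_c K l - (\<lambda>j. on_set K (L' (f j) v)) \<in> dual_cone (Fp K) (pair_p K) (Ep_plus K) \<longleftrightarrow>
        (\<forall>j. \<forall>p \<in> K. 0 \<le> l j p - L' (f j) v p)" (is "?d \<in> _ \<longleftrightarrow> _") if v: "v \<in> C1" for v
    proof -
      have d: "?d = (\<lambda>j. on_set K (\<lambda>p. l j p - L' (f j) v p))"
        by (auto simp: vec_c_def on_set_def fun_eq_iff)
      have "?d \<in> Fp K"
        unfolding d using l f v
        by (simp add: Fp_def on_set_in_C0 L'_continuous_on continuous_on_diff)
      then show ?thesis unfolding dual_cone_Ep_plus unfolding d by (simp add: on_set_def)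
    qed
    then show ?thesis
      by (auto simp: dual_feasible_def hjb_feasible_def adjoint_eq)
  qed
  have dual_objective: "pair_d (vec_b T x0 xT) v = v (T, xT) - v (0, x0)"
    if "v \<in> hjb_feasible K f l" for v
    using that by (simp add: pair_d_def vec_b_eq hjb_feasible_def)
  have "primal_value (pair_p K) (Ep_plus K) (op_A K f) (vec_b T x0 xT) (vec_c K l)
      = p_star T x0 xT K f l"
    by (simp add: primal_value_def p_star_def primal objective)
  moreover have "dual_value (Ep K) (Fp K) C1 (pair_p K) pair_d (Ep_plus K) (op_A K f)
      (vec_b T x0 xT) (vec_c K l) = d_star T x0 xT K f l"
    unfolding dual_value_def d_star_def dual by (intro SUP_cong) (simp_all add: dual_objective)
  ultimately show ?thesis
    using b by (auto simp: c A primal objective adjoint adjoint_eq dual dual_objective)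
qed

end
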